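(* Let $I_{init}=(m,\mathcal{J})$ be an instance of $P||C_{\max}$, let $f>1$ be real, let $k,\delta\ge 0$ be integers with $k<m$, and let $I_{new}=(\hat m,\hat{\mathcal{J}})$ be any perturbed instance belonging to the uncertainty set $\mathcal{U}(f,k,\delta)$ of $I_{init}$. Let $S_{init}$ be a LexOpt schedule for $I_{init}$ and let $S_{rec}$ be any schedule for $I_{new}$ produced from $S_{init}$ by the recovery strategy. Then $$C_{\max}(S_{rec})\ \le\ 2f\cdot\left(1+\left\lceil\frac{k}{m-k}\right\rceil\right)\cdot(f+k)\cdot\left(1+\left\lceil\frac{\delta}{m}\right\rceil\right)\cdot C_{\max}^*(\hat m,\hat{\mathcal{J}}).$$ That is, the LexOpt-based two-stage approach achieves a price of robustness of at most the displayed factor.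
   Context: $P||C_{\max}$: an instance $(m,\mathcal{J})$ consists of a set $\mathcal{M}$ of $m\ge 1$ parallel identical machines and a finite set $\mathcal{J}=\{J_1,\dots,J_n\}$ of jobs with processing times $p_j>0$. A schedule $S$ assigns each job to exactly one machine; the completion time $C_i(S)$ of machine $M_i$ is the sum of the processing times of its jobs, and the makespan is $C_{\max}(S)=\max_i C_i(S)$. $C_{\max}^*(m,\mathcal{J})$ is the minimum makespan over all schedules. LexOpt schedule: a schedule whose vector of machine completion times, sorted in non-increasing order, is lexicographically minimum among all schedules of the instance. Perturbed instance: $I_{new}=(\hat m,\hat{\mathcal{J}})$ has machine set $\hat{\mathcal{M}}$ with $|\hat{\mathcal{M}}|=\hat m\ge1$; it is obtained from $I_{init}$ by any series of the following: reductions and augmentations of processing times of jobs of $\mathcal{J}$, cancellations of jobs of $\mathcal{J}$, arrivals of new jobs, failures of machines of $\mathcal{M}$, activations of new machines. The processing time of job $J_j$ in $I_{new}$ is $\hat p_j$; a cancelled job is regarded as having $\hat p_j=0$. Uncertainty set $\mathcal{U}(f,k,\delta)$ of $(m,\mathcal{J})$: a job $J_j$ of $\mathcal{J}$ is stable if $p_j/f\le\hat p_j\le f p_j$ and unstable otherwise (so a cancelled job is unstable). $(\hat m,\hat{\mathcal{J}})\in\mathcal{U}(f,k,\delta)$ means that at most $k$ jobs of $\mathcal{J}$ are unstable and $\max\{\hat m-m,0\}\le\delta$. Newly arriving jobs are not counted in $k$, and the number of machine failures is not bounded. Recovery strategy: (1) every job $J_j\in\mathcal{J}\cap\hat{\mathcal{J}}$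 that $S_{init}$ assigns to a machine in $\mathcal{M}\cap\hat{\mathcal{M}}$ stays on that machine (with its new processing time $\hat p_j$); (2) all other jobs of $\hat{\mathcal{J}}$ (new jobs and jobs whose machine failed) are then assigned one by one in non-increasing order of processing time, each to a currently least loaded machine of $\hat{\mathcal{M}}$ (Longest Processing Time first; ties broken arbitrarily). *)

theory Defs
  imports Complex_Main "HOL-Library.FuncSet" "HOL-Library.Multiset"
begin

record ('m, 'j) sched_inst =
  machines :: "'m set"
  jobs :: "'j set"
  ptime :: "'j \<Rightarrow> real"

text \<open>
  Processing times are normalised to 0 outside the job set, so that a cancelled job \<open>j\<close> has
  \<open>ptime I' j = 0\<close> in the perturbed instance \<open>I'\<close>.
\<close>

definition valid_inst :: "('m, 'j) sched_inst \<Rightarrow> bool" where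
  "valid_inst I \<longleftrightarrow>
     finite (machines I) \<and> machines I \<noteq> {} \<and> finite (jobs I) \<and>
     (\<forall>j\<in>jobs I. ptime I j > 0) \<and> (\<forall>j. j \<notin> jobs I \<longrightarrow> ptime I j = 0)"

definition schedules :: "('m, 'j) sched_inst \<Rightarrow> ('j \<Rightarrow> 'm) set" where
  "schedules I = jobs I \<rightarrow>\<^sub>E machines I"

text \<open>The set \<open>A\<close> of jobs is explicit since loads of partial schedules are also needed.\<close>

definition load :: "('j \<Rightarrow> real) \<Rightarrow> 'j set \<Rightarrow> ('j \<Rightarrow> 'm) \<Rightarrow> 'm \<Rightarrow> real" where
  "load p A S i = (\<Sum>j\<in>{j\<in>A. S j = i}. p j)"

definition completion :: "('m, 'j) sched_inst \<Rightarrow> ('j \<Rightarrow> 'm) \<Rightarrow> 'm \<Rightarrow> real" where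
  "completion I S i = load (ptime I) (jobs I) S i"

definition makespan :: "('m, 'j) sched_inst \<Rightarrow> ('j \<Rightarrow> 'm) \<Rightarrow> real" where
  "makespan I S = Max (completion I S ` machines I)"

definition opt_makespan :: "('m, 'j) sched_inst \<Rightarrow> real" where
  "opt_makespan I = Min (makespan I ` schedules I)"

definition sorted_completions :: "('m, 'j) sched_inst \<Rightarrow> ('j \<Rightarrow> 'm) \<Rightarrow> real list" where
  "sorted_completions I S =
     rev (sorted_list_of_multiset (image_mset (completion I S) (mset_set (machines I))))"

definition lex_opt :: "('m, 'j) sched_inst \<Rightarrow> ('j \<Rightarrow> 'm) \<Rightarrow> bool" where
  "lex_opt I S \<longleftrightarrow>
     S \<in> schedules I \<and>
     (\<forall>T\<in>schedules I.
        sorted_completions I S = sorted_completions I T \<or>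
        (sorted_completions I S, sorted_completions I T) \<in> lexord {(x, y). x < y})"

text \<open>
  \<open>perturbed I I'\<close>: \<open>I'\<close> results from \<open>I\<close> by a finite series of elementary perturbations. Jobs and
  machines keep their identity, so new ones must lie outside those of the initial instance.
  Intermediate stages may have no machine at all.
\<close>

inductive perturbed :: "('m, 'j) sched_inst \<Rightarrow> ('m, 'j) sched_inst \<Rightarrow> bool"
  for I :: "('m, 'j) sched_inst" where
  unperturbed: "perturbed I I"
| reduction:
    "perturbed I I' \<Longrightarrow> j \<in> jobs I \<inter> jobs I' \<Longrightarrow> 0 < q \<Longrightarrow> q < ptime I' j \<Longrightarrow>
     perturbed I (I'\<lparr>ptime := (ptime I')(j := q)\<rparr>)"
| augmentation:
    "perturbed I I' \<Longrightarrow> j \<in> jobs I \<inter> jobs I' \<Longrightarrow> ptime I' j < q \<Longrightarrow>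
     perturbed I (I'\<lparr>ptime := (ptime I')(j := q)\<rparr>)"
| cancellation:
    "perturbed I I' \<Longrightarrow> j \<in> jobs I \<inter> jobs I' \<Longrightarrow>
     perturbed I (I'\<lparr>jobs := jobs I' - {j}, ptime := (ptime I')(j := 0)\<rparr>)"
| arrival:
    "perturbed I I' \<Longrightarrow> j \<notin> jobs I \<union> jobs I' \<Longrightarrow> 0 < q \<Longrightarrow>
     perturbed I (I'\<lparr>jobs := insert j (jobs I'), ptime := (ptime I')(j := q)\<rparr>)"
| failure:
    "perturbed I I' \<Longrightarrow> i \<in> machines I \<inter> machines I' \<Longrightarrow>
     perturbed I (I'\<lparr>machines := machines I' - {i}\<rparr>)"
| activation:
    "perturbed I I' \<Longrightarrow> i \<notin> machines I \<union> machines I' \<Longrightarrow>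
     perturbed I (I'\<lparr>machines := insert i (machines I')\<rparr>)"

definition stable :: "real \<Rightarrow> ('m, 'j) sched_inst \<Rightarrow> ('m, 'j) sched_inst \<Rightarrow> 'j \<Rightarrow> bool" where
  "stable f I I' j \<longleftrightarrow> ptime I j / f \<le> ptime I' j \<and> ptime I' j \<le> f * ptime I j"

definition uncertainty_set ::
  "real \<Rightarrow> nat \<Rightarrow> nat \<Rightarrow> ('m, 'j) sched_inst \<Rightarrow> ('m, 'j) sched_inst set" where
  "uncertainty_set f k \<delta> I =
     {I'. valid_inst I' \<and> perturbed I I' \<and>
          card {j\<in>jobs I. \<not> stable f I I' j} \<le> k \<and>
          max (int (card (machines I')) - int (card (machines I))) 0 \<le> int \<delta>}"

text \<open>
  \<open>greedy M p A S js T\<close>: starting from the partial schedule \<open>S\<close> of the jobs \<open>A\<close>, the jobs in the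
  list \<open>js\<close> are assigned in this order, each to a currently least loaded machine of \<open>M\<close>, resulting
  in \<open>T\<close>. The choice among tied machines is left open.
\<close>

inductive greedy ::
  "'m set \<Rightarrow> ('j \<Rightarrow> real) \<Rightarrow> 'j set \<Rightarrow> ('j \<Rightarrow> 'm) \<Rightarrow> 'j list \<Rightarrow> ('j \<Rightarrow> 'm) \<Rightarrow> bool"
  for M :: "'m set" and p :: "'j \<Rightarrow> real" where
  greedy_Nil: "greedy M p A S [] S"
| greedy_Cons:
    "i \<in> M \<Longrightarrow> (\<And>i'. i' \<in> M \<Longrightarrow> load p A S i \<le> load p A S i') \<Longrightarrow>
     greedy M p (insert j A) (S(j := i)) js T \<Longrightarrow> greedy M p A S (j # js) T"

definition kept_jobs ::
  "('m, 'j) sched_inst \<Rightarrow> ('m, 'j) sched_inst \<Rightarrow> ('j \<Rightarrow> 'm) \<Rightarrow> 'j set" where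
  "kept_jobs I I' S = {j \<in> jobs I \<inter> jobs I'. S j \<in> machines I \<inter> machines I'}"

definition recovery ::
  "('m, 'j) sched_inst \<Rightarrow> ('m, 'j) sched_inst \<Rightarrow> ('j \<Rightarrow> 'm) \<Rightarrow> ('j \<Rightarrow> 'm) \<Rightarrow> bool" where
  "recovery I I' S T \<longleftrightarrow>
     (\<exists>js. distinct js \<and> set js = jobs I' - kept_jobs I I' S \<and>
           sorted_wrt (\<lambda>a b. ptime I' a \<ge> ptime I' b) js \<and>
           greedy (machines I') (ptime I') (kept_jobs I I' S)
             (restrict S (kept_jobs I I' S)) js T)"

end

theory Submission
  imports Defs
begin

text \<open>
  Optimality in the lexicographic order implies local optimality: removing any job from its
  machine leaves at most the load of any other machine. Hence a machine carrying two or more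
  jobs has at most twice the load of any other one, in particular of each of the at least
  \<open>m - k\<close> machines that carry stable jobs only. The total initial size of the stable jobs is
  at most \<open>f\<close> times their total new size, so at most \<open>f * (m + \<delta>)\<close> times the new optimum;
  this bounds the stable load of such a machine, and a single stable job has initial size at
  most \<open>f\<close> times the new optimum. Passing to the new sizes costs another factor \<open>f\<close> for stable
  jobs, while each of the at most \<open>k\<close> unstable ones contributes at most one optimum. Finally, a
  greedy step only touches a machine whose load is at most the average, so it never creates a
  load above twice the optimum.
\<close>

section \<open>Loads\<close>

lemma load_insert:
  assumes "finite A" "j \<notin> A"
  shows "load p (insert j A) S i = load p A S i + (if S j = i then p j else 0)"
proof (cases "S j = i")
  case True
  then have "{x \<in> insert j A. S x = i} = insert j {x \<in> A. S x = i}" by auto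
  with assms True show ?thesis by (simp add: load_def)
next
  case False
  then have "{x \<in> insert j A. S x = i} = {x \<in> A. S x = i}" by auto
  with False show ?thesis by (simp add: load_def)
qed

lemma load_cong:
  assumes "\<And>j. j \<in> A \<Longrightarrow> S j = T j"
  shows "load p A S i = load p A T i"
  unfolding load_def using assms by (intro sum.cong) auto

lemma load_upd_new:
  assumes "finite A" "j \<notin> A"
  shows "load p (insert j A) (S(j := x)) i = load p A S i + (if x = i then p j else 0)"
proof -
  have "load p A (S(j := x)) i = load p A S i"
    by (rule load_cong) (use assms in auto)
  then show ?thesis by (simp add: load_insert[OF assms])
qed

lemma load_reassign:
  assumes "finite A" "j \<in> A"
  shows "load p A (S(j := x)) i =
    load p A S i - (if S j = i then p j else 0) + (if x = i then p j else 0)"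
proof -
  have A: "insert j (A - {j}) = A" using assms by auto
  show ?thesis
    using load_insert[of "A - {j}" j p S i] load_upd_new[of "A - {j}" j p S x i] assms
    unfolding A by simp
qed

lemma sum_load:
  assumes "finite A" "finite M"
  shows "(\<Sum>i\<in>M. load p A S i) = sum p {j \<in> A. S j \<in> M}"
proof -
  have "(\<Sum>i\<in>M. sum p {j \<in> {j \<in> A. S j \<in> M}. S j = i}) = sum p {j \<in> A. S j \<in> M}"
    by (rule sum.group) (use assms in auto)
  moreover have "{j \<in> {j \<in> A. S j \<in> M}. S j = i} = {j \<in> A. S j = i}" if "i \<in> M" for i
    using that by auto
  ultimately show ?thesis by (simp add: load_def cong: sum.cong)
qed

section \<open>The optimal makespan\<close>

lemma load_le_makespan:
  assumes "valid_inst I" "i \<in> machines I"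
  shows "load (ptime I) (jobs I) S i \<le> makespan I S"
  using assms unfolding makespan_def valid_inst_def completion_def by (intro Max_ge) auto

lemma opt_makespan_attained:
  assumes "valid_inst I"
  obtains S where "S \<in> schedules I" "opt_makespan I = makespan I S"
proof -
  have "finite (schedules I)" "schedules I \<noteq> {}"
    using assms by (auto simp: schedules_def valid_inst_def PiE_eq_empty_iff intro: finite_PiE)
  then have "opt_makespan I \<in> makespan I ` schedules I"
    unfolding opt_makespan_def by (intro Min_in) auto
  then show ?thesis using that by auto
qed

lemma ptime_nonneg: "valid_inst I \<Longrightarrow> 0 \<le> ptime I j"
  by (metis order.refl order.strict_implies_order valid_inst_def)

lemma sum_ptime_le_opt_makespan:
  assumes "valid_inst I"
  shows "sum (ptime I) (jobs I) \<le> real (card (machines I)) * opt_makespan I"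
proof -
  obtain S where S: "S \<in> schedules I" "opt_makespan I = makespan I S"
    by (rule opt_makespan_attained[OF assms])
  have "{j \<in> jobs I. S j \<in> machines I} = jobs I"
    using S(1) by (auto simp: schedules_def)
  then have "sum (ptime I) (jobs I) = (\<Sum>i\<in>machines I. load (ptime I) (jobs I) S i)"
    using assms by (simp add: sum_load valid_inst_def)
  also have "\<dots> \<le> real (card (machines I)) * opt_makespan I"
    unfolding S(2) by (rule sum_bounded_above) (rule load_le_makespan[OF assms])
  finally show ?thesis .
qed

lemma opt_makespan_nonneg:
  assumes "valid_inst I"
  shows "0 \<le> opt_makespan I"
proof -
  have "0 \<le> real (card (machines I)) * opt_makespan I"
    using sum_ptime_le_opt_makespan[OF assms] ptime_nonneg[OF assms]
    by (meson order_trans sum_nonneg)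
  moreover have "card (machines I) > 0" using assms by (simp add: valid_inst_def card_gt_0_iff)
  ultimately show ?thesis by (simp add: zero_le_mult_iff)
qed

lemma ptime_le_opt_makespan:
  assumes "valid_inst I"
  shows "ptime I j \<le> opt_makespan I"
proof (cases "j \<in> jobs I")
  case True
  obtain S where S: "S \<in> schedules I" "opt_makespan I = makespan I S"
    by (rule opt_makespan_attained[OF assms])
  have "ptime I j \<le> load (ptime I) (jobs I) S (S j)"
    unfolding load_def
    by (rule member_le_sum) (use assms True in \<open>auto simp: valid_inst_def ptime_nonneg\<close>)
  also have "\<dots> \<le> opt_makespan I"
    unfolding S(2) using S(1) True by (intro load_le_makespan[OF assms]) (auto simp: schedules_def)
  finally show ?thesis .
next
  case False
  then show ?thesis using assms opt_makespan_nonneg[OF assms] by (simp add: valid_inst_def)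
qed

section \<open>Greedy assignment\<close>

text \<open>\<open>B\<close> stands for the optimum, which bounds every job and, through the total,
  the average load. The least loaded machine then carries at most \<open>B\<close>, and at most
  \<open>2 * B\<close> after receiving its job. \<open>Z\<close> is a separate parameter because the
  loads of the given partial schedule may exceed \<open>2 * B\<close>.\<close>

lemma greedy_load_le:
  assumes "greedy M p A S js T"
    and "finite M" "finite A" "distinct js" "A \<inter> set js = {}"
    and "\<And>j. 0 \<le> p j" "\<And>j. p j \<le> B"
    and "sum p (A \<union> set js) \<le> real (card M) * B"
    and "2 * B \<le> Z" "\<And>i. i \<in> M \<Longrightarrow> load p A S i \<le> Z" "i \<in> M"
  shows "load p (A \<union> set js) T i \<le> Z"
  using assms
proof (induction arbitrary: i rule: greedy.induct)
  case (greedy_Nil A S)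
  then show ?case by simp
next
  case (greedy_Cons l A S j js T)
  have "real (card M) * load p A S l \<le> (\<Sum>i\<in>M. load p A S i)"
    using greedy_Cons.hyps(2) by (intro sum_bounded_below)
  also have "\<dots> = sum p {j \<in> A. S j \<in> M}"
    using greedy_Cons.prems by (intro sum_load)
  also have "\<dots> \<le> sum p (A \<union> set (j # js))"
    using greedy_Cons.prems by (intro sum_mono2) auto
  also have "\<dots> \<le> real (card M) * B" by (rule greedy_Cons.prems)
  finally have "load p A S l \<le> B"
    using greedy_Cons.hyps(1) greedy_Cons.prems(1) by (auto simp: card_gt_0_iff mult_le_cancel_left)
  then have step: "load p (insert j A) (S(j := l)) i' \<le> Z" if "i' \<in> M" for i'
    using greedy_Cons.prems(6)[of j] greedy_Cons.prems(8) greedy_Cons.prems(9)[OF that]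
      greedy_Cons.prems(2,4) by (cases "i' = l") (auto simp: load_upd_new)
  have eq: "A \<union> set (j # js) = insert j A \<union> set js" by auto
  show ?case
    unfolding eq
    by (rule greedy_Cons.IH) (use greedy_Cons.prems step in \<open>auto simp del: fun_upd_apply\<close>)
qed

section \<open>Local optimality of lexicographically optimal schedules\<close>

text \<open>Detaches the sorting in \<open>sorted_completions\<close> from machines and schedules,
  so that entries common to two schedules can be split off as a multiset.\<close>

definition desc_list :: "'a::linorder multiset \<Rightarrow> 'a list" where
  "desc_list M = rev (sorted_list_of_multiset M)"

lemma desc_list_add_max:
  assumes "\<And>y. y \<in># M \<Longrightarrow> y \<le> x"
  shows "desc_list (add_mset x M) = x # desc_list M"
proof -
  let ?l = "sorted_list_of_multiset M @ [x]"
  have "sorted ?l" using assms by (auto simp: sorted_append)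
  then have "sorted_list_of_multiset (mset ?l) = ?l"
    by (simp only: sorted_list_of_multiset_mset sorted_sort_id)
  then show ?thesis by (simp add: desc_list_def)
qed

text \<open>Entries of \<open>N\<close> that are at least \<open>a\<close> form the same initial
  segment of both lists. Once they are removed, the right list starts with \<open>a\<close>, while
  every entry of the left one is smaller.\<close>

lemma desc_list_less:
  fixes a b c d :: "'a::linorder"
  assumes "b < a" "c < a" "d < a"
  shows "(desc_list (N + {#c, d#}), desc_list (N + {#a, b#})) \<in> lexord {(x, y). x < y}"
proof (induction "size N" arbitrary: N rule: less_induct)
  case less
  show ?case
  proof (cases "\<exists>x\<in>#N. a \<le> x")
    case True
    define x where "x = Max (set_mset N)"
    \<comment> \<open>The maximum \<open>x\<close> of \<open>N\<close> dominates \<open>a\<close>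
      and hence also \<open>b\<close>, \<open>c\<close>, \<open>d\<close>, so it heads both lists
      and the induction hypothesis applies to the tails.\<close>
    have x: "x \<in># N" "\<And>y. y \<in># N \<Longrightarrow> y \<le> x"
      using True unfolding x_def by (auto intro!: Max_in)
    then have "a \<le> x" using True by force
    obtain N' where N: "N = add_mset x N'" using x(1) by (metis mset_add)
    have peel: "desc_list (N + {#u, v#}) = x # desc_list (N' + {#u, v#})" if "u \<le> x" "v \<le> x" for u v
    proof -
      have "N + {#u, v#} = add_mset x (N' + {#u, v#})" by (simp add: N)
      then show ?thesis
        using that x(2) by (simp only:, intro desc_list_add_max) (auto simp: N)
    qed
    have "desc_list (N + {#c, d#}) = x # desc_list (N' + {#c, d#})"
      by (rule peel) (use assms \<open>a \<le> x\<close> in auto)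
    moreover have "desc_list (N + {#a, b#}) = x # desc_list (N' + {#a, b#})"
      by (rule peel) (use assms \<open>a \<le> x\<close> in auto)
    ultimately show ?thesis using less[of N'] by (simp add: N)
  next
    case False
    have "desc_list (N + {#a, b#}) = a # desc_list (N + {#b#})"
      using desc_list_add_max[of "N + {#b#}" a] False assms by force
    moreover obtain y ys where y: "desc_list (N + {#c, d#}) = y # ys"
      by (cases "desc_list (N + {#c, d#})") (auto simp: desc_list_def dest: arg_cong[of _ _ mset])
    moreover have "y < a"
    proof -
      have "y \<in> set (desc_list (N + {#c, d#}))" by (simp only: y list.set_intros)
      then have "y \<in># N + {#c, d#}"
        by (simp only: desc_list_def set_rev set_sorted_list_of_multiset)
      then show ?thesis using False assms by auto
    qed
    ultimately show ?thesis by simp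
  qed
qed

text \<open>Otherwise moving \<open>j\<close> to machine \<open>i\<close> would replace the
  completion times of \<open>S j\<close> and \<open>i\<close> by two values both strictly below that
  of \<open>S j\<close>, a lexicographic improvement by \<open>desc_list_less\<close>.\<close>

lemma lex_opt_move:
  assumes "valid_inst I" "lex_opt I S" "j \<in> jobs I" "i \<in> machines I"
  shows "completion I S (S j) - ptime I j \<le> completion I S i"
proof (rule ccontr)
  assume less: "\<not> ?thesis"
  let ?T = "S(j := i)"
  let ?R = "machines I - {S j, i}"
  have S: "S \<in> schedules I" and p: "0 < ptime I j"
    and fin: "finite (machines I)" "finite (jobs I)"
    using assms by (auto simp: lex_opt_def valid_inst_def)
  then have Sj: "S j \<in> machines I" and T: "?T \<in> schedules I"
    using assms by (auto simp: schedules_def PiE_iff extensional_def)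
  have ne: "S j \<noteq> i" using less p by auto
  have comp: "completion I ?T x = completion I S x - (if S j = x then ptime I j else 0)
      + (if i = x then ptime I j else 0)" for x
    unfolding completion_def by (rule load_reassign) (use fin assms in auto)
  \<comment> \<open>The machines in \<open>?R\<close> keep their completion times and supply the
    common part \<open>N\<close>.\<close>
  have M: "machines I = insert (S j) (insert i ?R)" using Sj assms by auto
  have ms: "mset_set (machines I) = add_mset (S j) (add_mset i (mset_set ?R))"
    by (subst M) (use fin ne in auto)
  have same: "image_mset (completion I ?T) (mset_set ?R) = image_mset (completion I S) (mset_set ?R)"
    by (rule image_mset_cong) (use fin in \<open>auto simp: comp\<close>)
  define N where "N = image_mset (completion I S) (mset_set ?R)"
  have "sorted_completions I S = desc_list (N + {#completion I S (S j), completion I S i#})"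
    by (simp add: sorted_completions_def desc_list_def N_def ms)
  moreover have "sorted_completions I ?T =
      desc_list (N + {#completion I S (S j) - ptime I j, completion I S i + ptime I j#})"
    using ne by (simp add: sorted_completions_def desc_list_def ms same comp N_def del: fun_upd_apply)
  ultimately have TS: "(sorted_completions I ?T, sorted_completions I S) \<in> lexord {(x, y). x < y}"
    using less p by (simp only:, intro desc_list_less) auto
  have irr: "(l, l) \<notin> lexord {(x, y). x < y}" for l :: "real list"
    by (rule lexord_irreflexive) auto
  \<comment> \<open>By optimality the vector of \<open>S\<close> equals that of \<open>?T\<close> or
    precedes it; with \<open>TS\<close> either case makes some vector precede itself.\<close>
  have "trans {(x, y). x < (y::real)}" by (auto simp: trans_def)
  then show False
    using TS irr assms(2) T unfolding lex_opt_def by (metis lexord_trans)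
qed

text \<open>Add the inequalities of \<open>lex_opt_move\<close> for both jobs: together the two jobs
  account for at most one completion time of their machine.\<close>

lemma lex_opt_le_twice:
  assumes "valid_inst I" "lex_opt I S" "i \<in> machines I"
    and "j \<in> jobs I" "j' \<in> jobs I" "j \<noteq> j'" "S j = S j'"
  shows "completion I S (S j) \<le> 2 * completion I S i"
proof -
  have "ptime I j + ptime I j' = sum (ptime I) {j, j'}" using assms(6) by simp
  also have "\<dots> \<le> completion I S (S j)"
    unfolding completion_def load_def
    by (rule sum_mono2) (use assms in \<open>auto simp: valid_inst_def ptime_nonneg\<close>)
  finally show ?thesis
    using lex_opt_move[OF assms(1,2,4,3)] lex_opt_move[OF assms(1,2,5,3)] assms(7) by simp
qed

section \<open>Stable jobs in the initial schedule\<close>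

text \<open>The two fractional factors multiply to \<open>(m + \<delta>) / (m - k)\<close>: the new
  work is at most \<open>m + \<delta>\<close> optima, and at least \<open>m - k\<close> machines
  carry no unstable job.\<close>

lemma stable_load_le:
  assumes I: "valid_inst I" and I': "valid_inst I'" and opt: "lex_opt I S"
    and f: "f > 1" and k: "k < card (machines I)"
    and unstable: "card {j \<in> jobs I. \<not> stable f I I' j} \<le> k"
    and card: "card (machines I') \<le> card (machines I) + \<delta>"
  defines "m \<equiv> real (card (machines I))"
  shows "load (ptime I) {j \<in> jobs I. stable f I I' j} S i
    \<le> 2 * f * (1 + real k / (m - real k)) * (1 + real \<delta> / m) * opt_makespan I'"
proof -
  let ?St = "{j \<in> jobs I. stable f I I' j}" and ?U = "{j \<in> jobs I. \<not> stable f I I' j}"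
  let ?O = "opt_makespan I'"
  let ?p = "ptime I"
  have fin: "finite (jobs I)" "finite (machines I)" "finite (jobs I')"
    using I I' by (auto simp: valid_inst_def)
  have O: "0 \<le> ?O" by (rule opt_makespan_nonneg[OF I'])
  have m: "real k < m" using k by (simp add: m_def)
  have stable: "?p j \<le> f * ptime I' j" if "j \<in> ?St" for j
    using that f by (simp add: stable_def divide_le_eq mult.commute)
  show ?thesis
  proof (cases "\<exists>j\<in>jobs I. \<exists>j'\<in>jobs I. j \<noteq> j' \<and> S j = i \<and> S j' = i")
    case True
    have half: "completion I S i \<le> 2 * completion I S l" if "l \<in> machines I" for l
      using True lex_opt_le_twice[OF I opt that] by auto
    \<comment> \<open>Machines without unstable jobs. Summing \<open>half\<close> over them bounds
      \<open>completion I S i\<close> by an average of purely stable loads.\<close>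
    define F where "F = machines I - S ` ?U"
    have "card (S ` ?U) \<le> k"
      using unstable card_image_le[of ?U S] fin by simp
    then have "card (machines I) - k \<le> card F"
      using diff_card_le_card_Diff[of "S ` ?U" "machines I"] fin unfolding F_def by simp
    then have F: "m - real k \<le> real (card F)" using k by (simp add: m_def)
    have C: "0 \<le> completion I S i"
      unfolding completion_def load_def by (intro sum_nonneg ptime_nonneg[OF I])
    have "(m - real k) * completion I S i \<le> real (card F) * completion I S i"
      using F C by (rule mult_right_mono)
    also have "\<dots> \<le> (\<Sum>l\<in>F. 2 * completion I S l)"
      by (rule sum_bounded_below) (use half in \<open>auto simp: F_def\<close>)
    also have "\<dots> = 2 * sum ?p {j \<in> jobs I. S j \<in> F}"
      using fin by (simp add: completion_def sum_load F_def flip: sum_distrib_left)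
    also have "sum ?p {j \<in> jobs I. S j \<in> F} \<le> sum ?p ?St"
      by (rule sum_mono2) (use fin I in \<open>auto simp: F_def ptime_nonneg\<close>)
    also have "\<dots> \<le> (\<Sum>j\<in>?St. f * ptime I' j)"
      by (rule sum_mono) (rule stable)
    also have "\<dots> = f * sum (ptime I') ?St" by (simp add: sum_distrib_left)
    \<comment> \<open>Processing times vanish outside \<open>jobs I'\<close>.\<close>
    also have "sum (ptime I') ?St = sum (ptime I') (?St \<inter> jobs I')"
      by (rule sum.mono_neutral_right) (use fin I' in \<open>auto simp: valid_inst_def\<close>)
    also have "\<dots> \<le> sum (ptime I') (jobs I')"
      by (rule sum_mono2) (use fin I' in \<open>auto simp: ptime_nonneg\<close>)
    also have "\<dots> \<le> real (card (machines I')) * ?O"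
      by (rule sum_ptime_le_opt_makespan[OF I'])
    also have "\<dots> \<le> (m + real \<delta>) * ?O"
      using card O unfolding m_def by (intro mult_right_mono) auto
    finally have "(m - real k) * completion I S i \<le> 2 * (f * ((m + real \<delta>) * ?O))"
      using f by simp
    then have "completion I S i \<le> 2 * (f * ((m + real \<delta>) * ?O)) / (m - real k)"
      using m by (simp add: le_divide_eq mult.commute)
    also have "\<dots> = 2 * f * (1 + real k / (m - real k)) * (1 + real \<delta> / m) * ?O"
    proof -
      have "1 + real k / (m - real k) = m / (m - real k)" "1 + real \<delta> / m = (m + real \<delta>) / m"
        using m by (simp_all add: field_simps)
      moreover have "m \<noteq> 0" using m by auto
      ultimately show ?thesis by simp
    qed
    finally have "completion I S i \<le> \<dots>" .
    moreover have "load ?p ?St S i \<le> completion I S i"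
      unfolding completion_def load_def
      by (rule sum_mono2) (use fin I in \<open>auto simp: ptime_nonneg\<close>)
    ultimately show ?thesis by linarith
  next
    case False
    \<comment> \<open>At most one job runs on \<open>i\<close>, and a stable job's initial size is
      at most \<open>f\<close> times its new size.\<close>
    have "load ?p ?St S i \<le> f * ?O"
    proof (cases "\<exists>j\<in>?St. S j = i")
      case True
      then obtain j where j: "j \<in> ?St" "S j = i" by auto
      with False have "{j \<in> ?St. S j = i} = {j}" by auto
      then have "load ?p ?St S i = ?p j" by (simp add: load_def)
      also have "\<dots> \<le> f * ptime I' j" by (rule stable[OF j(1)])
      also have "\<dots> \<le> f * ?O"
        using f by (intro mult_left_mono ptime_le_opt_makespan[OF I']) auto
      finally show ?thesis .
    next
      case False
      then have "{j \<in> ?St. S j = i} = {}" by blast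
      then have "load ?p ?St S i = 0" unfolding load_def by (simp only: sum.empty)
      then show ?thesis using f O by simp
    qed
    also have "\<dots> \<le> (2 * (1 + real k / (m - real k)) * (1 + real \<delta> / m)) * (f * ?O)"
    proof -
      have "1 * 1 \<le> (1 + real k / (m - real k)) * (1 + real \<delta> / m)"
        using m by (intro mult_mono) auto
      then have "1 \<le> 2 * (1 + real k / (m - real k)) * (1 + real \<delta> / m)"
        unfolding mult.assoc by linarith
      then have "1 * (f * ?O) \<le> (2 * (1 + real k / (m - real k)) * (1 + real \<delta> / m)) * (f * ?O)"
        by (rule mult_right_mono) (use f O in auto)
      then show ?thesis by simp
    qed
    finally show ?thesis by (simp add: mult_ac)
  qed
qed

text \<open>The passage to new sizes: stable jobs grow by a factor of at most \<open>f\<close>, and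
  each of the at most \<open>k\<close> unstable jobs costs at most one new optimum.\<close>

lemma kept_load_le:
  assumes I: "valid_inst I" and I': "valid_inst I'"
    and unstable: "card {j \<in> jobs I. \<not> stable f I I' j} \<le> k"
  shows "load (ptime I') (kept_jobs I I' S) S i
    \<le> f * load (ptime I) {j \<in> jobs I. stable f I I' j} S i + real k * opt_makespan I'"
proof -
  let ?St = "{j \<in> jobs I. stable f I I' j}" and ?U = "{j \<in> jobs I. \<not> stable f I I' j}"
  let ?q = "ptime I'"
  have fin: "finite (jobs I)" using I by (simp add: valid_inst_def)
  \<comment> \<open>All unstable jobs are charged to machine \<open>i\<close>, wherever
    \<open>S\<close> puts them.\<close>
  have "load ?q (kept_jobs I I' S) S i \<le> sum ?q ({j \<in> ?St. S j = i} \<union> ?U)"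
    unfolding load_def
    by (rule sum_mono2) (use fin in \<open>auto simp: kept_jobs_def ptime_nonneg[OF I']\<close>)
  also have "\<dots> = sum ?q {j \<in> ?St. S j = i} + sum ?q ?U"
    by (rule sum.union_disjoint) (use fin in auto)
  also have "sum ?q {j \<in> ?St. S j = i} \<le> (\<Sum>j\<in>{j \<in> ?St. S j = i}. f * ptime I j)"
    by (rule sum_mono) (auto simp: stable_def)
  also have "\<dots> = f * load (ptime I) ?St S i" by (simp add: load_def sum_distrib_left)
  also have "sum ?q ?U \<le> real (card ?U) * opt_makespan I'"
    by (rule sum_bounded_above) (rule ptime_le_opt_makespan[OF I'])
  also have "\<dots> \<le> real k * opt_makespan I'"
    using unstable opt_makespan_nonneg[OF I'] by (intro mult_right_mono) auto
  finally show ?thesis by simp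
qed

theorem theorem5:
  fixes I_init I_new :: "('m, 'j) sched_inst"
    and S_init S_rec :: "'j \<Rightarrow> 'm"
    and f :: real and k \<delta> m :: nat
  assumes "valid_inst I_init"
    and "m = card (machines I_init)"
    and "f > 1"
    and "k < m"
    and "I_new \<in> uncertainty_set f k \<delta> I_init"
    and "lex_opt I_init S_init"
    and "recovery I_init I_new S_init S_rec"
  shows "makespan I_new S_rec \<le>
    2 * f * (1 + real_of_int \<lceil>real k / (real m - real k)\<rceil>) * (f + real k)
      * (1 + real_of_int \<lceil>real \<delta> / real m\<rceil>) * opt_makespan I_new"
    (is "_ \<le> ?Z")
proof -
  note I = \<open>valid_inst I_init\<close>
  let ?K = "kept_jobs I_init I_new S_init" and ?p = "ptime I_new" and ?O = "opt_makespan I_new"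
  have I': "valid_inst I_new" and unstable: "card {j \<in> jobs I_init. \<not> stable f I_init I_new j} \<le> k"
    and card: "card (machines I_new) \<le> card (machines I_init) + \<delta>"
    using assms(5) by (auto simp: uncertainty_set_def)
  have O: "0 \<le> ?O" by (rule opt_makespan_nonneg[OF I'])
  have fin: "finite (jobs I_new)" "finite (machines I_new)" "machines I_new \<noteq> {}"
    using I' by (auto simp: valid_inst_def)
  define a where "a = 1 + real_of_int \<lceil>real k / (real m - real k)\<rceil>"
  define b where "b = 1 + real_of_int \<lceil>real \<delta> / real m\<rceil>"
  have a: "1 + real k / (real m - real k) \<le> a" and b: "1 + real \<delta> / real m \<le> b"
    by (simp_all add: a_def b_def)
  have pos: "0 \<le> real k / (real m - real k)" "0 \<le> real \<delta> / real m"
    using assms(4) by auto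
  \<comment> \<open>These lower bounds let terms lacking the factors \<open>f\<close>,
    \<open>a\<close>, \<open>b\<close> be absorbed into \<open>?Z\<close>.\<close>
  have ab: "1 \<le> a * b" using mult_mono[of 1 a 1 b] a b pos by simp
  have fab: "1 \<le> f * (a * b)" using mult_mono[of 1 f 1 "a * b"] ab assms(3) by simp
  have Z: "?Z = 2 * (f * (a * b)) * (f + real k) * ?O" by (simp add: a_def b_def mult_ac)
  have "2 * 1 * 1 * ?O \<le> 2 * (f * (a * b)) * (f + real k) * ?O"
    using fab assms(3) O by (intro mult_right_mono mult_mono) auto
  then have twice: "2 * ?O \<le> ?Z" unfolding Z by simp
  have kept: "load ?p ?K S_init i \<le> ?Z" if i: "i \<in> machines I_new" for i
  proof (cases "i \<in> machines I_init")
    case True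
    have "load (ptime I_init) {j \<in> jobs I_init. stable f I_init I_new j} S_init i
      \<le> 2 * f * (1 + real k / (real m - real k)) * (1 + real \<delta> / real m) * ?O"
      using stable_load_le[OF I I' assms(6,3) _ unstable card] assms(2,4) by simp
    also have "\<dots> \<le> 2 * f * a * b * ?O"
      using a b pos assms(3) O by (intro mult_right_mono mult_mono) auto
    finally have "f * load (ptime I_init) {j \<in> jobs I_init. stable f I_init I_new j} S_init i
      \<le> f * (2 * f * a * b * ?O)"
      using assms(3) by (intro mult_left_mono) auto
    \<comment> \<open>The unstable contribution is inflated to share the factor
      \<open>2 * f * a * b\<close> with the stable one; the sum then yields
      \<open>f + k\<close>.\<close>
    moreover have "real k * ?O \<le> (2 * (f * (a * b))) * (real k * ?O)"
      using fab O mult_right_mono[of 1 "2 * (f * (a * b))" "real k * ?O"] by simp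
    ultimately show ?thesis
      using kept_load_le[OF I I' unstable, of S_init i]
      unfolding Z by (simp add: algebra_simps)
  next
    case False
    \<comment> \<open>Newly activated machines start empty.\<close>
    then have "{j \<in> ?K. S_init j = i} = {}" by (auto simp: kept_jobs_def)
    then have "load ?p ?K S_init i = 0" unfolding load_def by (simp only: sum.empty)
    then show ?thesis using twice O by linarith
  qed
  obtain js where js: "distinct js" "set js = jobs I_new - ?K"
    and greedy: "greedy (machines I_new) ?p ?K (restrict S_init ?K) js S_rec"
    using assms(7) unfolding recovery_def by blast
  have K: "?K \<subseteq> jobs I_new" by (auto simp: kept_jobs_def)
  then have jobs: "?K \<union> set js = jobs I_new" using js(2) by auto
  have "load ?p (jobs I_new) S_rec i \<le> ?Z" if i: "i \<in> machines I_new" for i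
    unfolding jobs[symmetric]
  \<comment> \<open>Here \<open>B\<close> is the new optimum and \<open>Z\<close> the claimed bound,
    which already holds for the kept jobs.\<close>
  proof (rule greedy_load_le[OF greedy fin(2) _ js(1) _ _ _ _ twice _ i])
    show "finite ?K" using fin K by (auto intro: finite_subset)
    show "?K \<inter> set js = {}" using js(2) by auto
    show "0 \<le> ?p j" "?p j \<le> ?O" for j
      by (rule ptime_nonneg[OF I'] ptime_le_opt_makespan[OF I'])+
    show "sum ?p (?K \<union> set js) \<le> real (card (machines I_new)) * ?O"
      unfolding jobs by (rule sum_ptime_le_opt_makespan[OF I'])
    show "load ?p ?K (restrict S_init ?K) l \<le> ?Z" if "l \<in> machines I_new" for l
      using kept[OF that] load_cong[of ?K "restrict S_init ?K" S_init ?p l] by simp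
  qed
  then show ?thesis
    unfolding makespan_def completion_def using fin by (intro Max.boundedI) auto
qed

end
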